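(* Let $\mathbb{F}$ be a field and let $\mathcal{A}$ be a finite dimensional algebra over $\mathbb{F}$ with unity. Then $\mathcal{A}$ is prime if and only if there exist a positive integer $n$ and a division algebra $\mathcal{D}$ over $\mathbb{F}$ such that $\mathcal{A}\cong M_n(\mathcal{D})$.
   Context: An algebra over a field $\mathbb{F}$ is an $\mathbb{F}$-vector space with a bilinear associative multiplication; it is not required to have a unity. A unity of an algebra $\mathcal{A}$ is a nonzero element $1_{\mathcal{A}}\in\mathcal{A}$ with $1_{\mathcal{A}}a=a1_{\mathcal{A}}=a$ for all $a\in\mathcal{A}$ (so an algebra with unity is nonzero). An algebra is finite dimensional if it is finite dimensional as an $\mathbb{F}$-vector space. A division algebra is an algebra with unity in which every nonzero element is invertible. $M_n(\mathcal{D})$ is the $\mathbb{F}$-algebra of $n\times n$ matrices with entries in $\mathcal{D}$ under the standard matrix operations. $\mathcal{A}\cong\mathcal{B}$ means that there is a bijective $\mathbb{F}$-linear map $\varphi:\mathcal{A}\to\mathcal{B}$ with $\varphi(ab)=\varphi(a)\varphi(b)$ for all $a,b\in\mathcal{A}$. An algebra $\mathcal{A}$ is prime if for all $a,b\in\mathcal{A}$, $a\mathcal{A}b=\{0\}$ implies $a=0$ or $b=0$, where $a\mathcal{A}b=\{axb\mid x\in\mathcal{A}\}$. *)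

theory Defs
  imports "Jordan_Normal_Form.Missing_VectorSpace" "Jordan_Normal_Form.Matrix"
begin

text \<open>
  Algebras are \<open>module\<close> records, whose fields include a multiplication. The locale
  \<open>vectorspace F A\<close> contains the assumption that \<open>F\<close> is a field. The HOL-Algebra locale
  \<open>algebra\<close> is not usable here: it makes the multiplication commutative and unital.
  In \<open>assoc_algebra\<close> the record field \<open>one\<close> is unconstrained, so no unity is required.
\<close>

locale assoc_algebra = vectorspace F A
  for F :: "('f, 'g) ring_scheme" and A :: "('f, 'a, 'h) module_scheme" +
  assumes mult_closed:
      "\<lbrakk>x \<in> carrier A; y \<in> carrier A\<rbrakk> \<Longrightarrow> x \<otimes>\<^bsub>A\<^esub> y \<in> carrier A"
    and mult_assoc:
      "\<lbrakk>x \<in> carrier A; y \<in> carrier A; z \<in> carrier A\<rbrakk>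
        \<Longrightarrow> (x \<otimes>\<^bsub>A\<^esub> y) \<otimes>\<^bsub>A\<^esub> z = x \<otimes>\<^bsub>A\<^esub> (y \<otimes>\<^bsub>A\<^esub> z)"
    and mult_add_left:
      "\<lbrakk>x \<in> carrier A; y \<in> carrier A; z \<in> carrier A\<rbrakk>
        \<Longrightarrow> (x \<oplus>\<^bsub>A\<^esub> y) \<otimes>\<^bsub>A\<^esub> z = x \<otimes>\<^bsub>A\<^esub> z \<oplus>\<^bsub>A\<^esub> y \<otimes>\<^bsub>A\<^esub> z"
    and mult_add_right:
      "\<lbrakk>x \<in> carrier A; y \<in> carrier A; z \<in> carrier A\<rbrakk>
        \<Longrightarrow> z \<otimes>\<^bsub>A\<^esub> (x \<oplus>\<^bsub>A\<^esub> y) = z \<otimes>\<^bsub>A\<^esub> x \<oplus>\<^bsub>A\<^esub> z \<otimes>\<^bsub>A\<^esub> y"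
    and mult_smult_left:
      "\<lbrakk>c \<in> carrier F; x \<in> carrier A; y \<in> carrier A\<rbrakk>
        \<Longrightarrow> (c \<odot>\<^bsub>A\<^esub> x) \<otimes>\<^bsub>A\<^esub> y = c \<odot>\<^bsub>A\<^esub> (x \<otimes>\<^bsub>A\<^esub> y)"
    and mult_smult_right:
      "\<lbrakk>c \<in> carrier F; x \<in> carrier A; y \<in> carrier A\<rbrakk>
        \<Longrightarrow> x \<otimes>\<^bsub>A\<^esub> (c \<odot>\<^bsub>A\<^esub> y) = c \<odot>\<^bsub>A\<^esub> (x \<otimes>\<^bsub>A\<^esub> y)"

text \<open>The record field \<open>one\<close> is the unity; a unity is nonzero by convention.\<close>

locale unital_algebra = assoc_algebra F A
  for F :: "('f, 'g) ring_scheme" and A :: "('f, 'a, 'h) module_scheme" +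
  assumes unity_closed: "\<one>\<^bsub>A\<^esub> \<in> carrier A"
    and unity_nonzero: "\<one>\<^bsub>A\<^esub> \<noteq> \<zero>\<^bsub>A\<^esub>"
    and unity_left: "x \<in> carrier A \<Longrightarrow> \<one>\<^bsub>A\<^esub> \<otimes>\<^bsub>A\<^esub> x = x"
    and unity_right: "x \<in> carrier A \<Longrightarrow> x \<otimes>\<^bsub>A\<^esub> \<one>\<^bsub>A\<^esub> = x"

locale division_algebra = unital_algebra F D
  for F :: "('f, 'g) ring_scheme" and D :: "('f, 'd, 'h) module_scheme" +
  assumes nonzero_invertible:
    "\<lbrakk>x \<in> carrier D; x \<noteq> \<zero>\<^bsub>D\<^esub>\<rbrakk> \<Longrightarrow> x \<in> Units D"

definition matrix_algebra ::
  "nat \<Rightarrow> ('f, 'd, 'h) module_scheme \<Rightarrow> ('f, 'd mat) module" where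
  "matrix_algebra n D =
    \<lparr>carrier = {X \<in> carrier_mat n n. elements_mat X \<subseteq> carrier D},
     monoid.mult = (\<lambda>X Y. mat n n
       (\<lambda>(i, j). \<Oplus>\<^bsub>D\<^esub>k\<in>{..<n}. X $$ (i, k) \<otimes>\<^bsub>D\<^esub> Y $$ (k, j))),
     one = mat n n (\<lambda>(i, j). if i = j then \<one>\<^bsub>D\<^esub> else \<zero>\<^bsub>D\<^esub>),
     zero = mat n n (\<lambda>(i, j). \<zero>\<^bsub>D\<^esub>),
     add = (\<lambda>X Y. mat n n (\<lambda>(i, j). X $$ (i, j) \<oplus>\<^bsub>D\<^esub> Y $$ (i, j))),
     smult = (\<lambda>c X. mat n n (\<lambda>(i, j). c \<odot>\<^bsub>D\<^esub> X $$ (i, j)))\<rparr>"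

text \<open>\<open>LinearCombinations.module_hom\<close> is \<open>F\<close>-linearity; \<open>hom\<close> refers to the multiplication only.\<close>

definition algebra_isomorphic ::
  "('f, 'g) ring_scheme \<Rightarrow> ('f, 'a, 'h) module_scheme
    \<Rightarrow> ('f, 'b, 'k) module_scheme \<Rightarrow> bool" where
  "algebra_isomorphic F A B \<longleftrightarrow>
    (\<exists>\<phi>. \<phi> \<in> LinearCombinations.module_hom F A B \<and> \<phi> \<in> hom A B \<and> bij_betw \<phi> (carrier A) (carrier B))"

definition prime_algebra :: "('f, 'a, 'h) module_scheme \<Rightarrow> bool" where
  "prime_algebra A \<longleftrightarrow>
    (\<forall>a\<in>carrier A. \<forall>b\<in>carrier A.
      (\<lambda>x. a \<otimes>\<^bsub>A\<^esub> x \<otimes>\<^bsub>A\<^esub> b) ` carrier A = {\<zero>\<^bsub>A\<^esub>}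
        \<longrightarrow> a = \<zero>\<^bsub>A\<^esub> \<or> b = \<zero>\<^bsub>A\<^esub>)"

end

theory Submission
  imports Defs
begin

text \<open>
  If \<open>A\<close> is prime, a minimal nonzero left ideal contains an idempotent \<open>e\<close> such that \<open>e A e\<close> is a
  division algebra. Take \<open>u i \<in> A e\<close> and \<open>v i \<in> e A\<close> for \<open>i < n\<close> with
  \<open>v i u j = (if i = j then e else 0)\<close> and \<open>n\<close> maximal; \<open>n\<close> is bounded by the dimension because the
  \<open>u i\<close> are linearly independent. Then \<open>f = \<Sum> u i v i\<close> is an idempotent, and \<open>f = 1\<close>: otherwise
  primeness provides \<open>x\<close> and \<open>y\<close> with \<open>e y (1 - f) x e \<noteq> 0\<close>, which is invertible in \<open>e A e\<close>, so the
  family can be extended. Hence \<open>a \<mapsto> (v i a u j)\<close> is an isomorphism onto the matrices over \<open>e A e\<close>.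
  Conversely, if two matrices have nonzero entries \<open>X (i, j)\<close> and \<open>Y (k, l)\<close>, the product
  \<open>X E Y\<close> with the matrix unit \<open>E\<close> at \<open>(j, k)\<close> has the entry \<open>X (i, j) Y (k, l) \<noteq> 0\<close>.
\<close>

section \<open>Minimal subspaces with a given property in finite dimension\<close>

lemma (in vectorspace) lin_indpt_insert:
  assumes "submodule K W V" "S \<subseteq> W" "lin_indpt S" "v \<in> carrier V" "v \<notin> W"
  shows "lin_indpt (insert v S)"
proof -
  have W: "W \<subseteq> carrier V"
    using assms(1) by (simp add: submodule_def)
  have "v \<notin> span S"
    using span_is_subset[OF assms(2,1)] assms(5) by blast
  then show ?thesis
    using lin_dep_iff_in_span[of S v] assms W by auto
qed

text \<open>Descent on dimension, measured by the sizes of linearly independent subsets so that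
  subspaces need no dimension of their own. If \<open>U\<close> is strictly inside \<open>W\<close>,
  every independent subset of \<open>U\<close> can be enlarged by one vector of \<open>W\<close>
  outside \<open>U\<close>, so \<open>U\<close> satisfies a smaller bound than
  \<open>W\<close>.\<close>

lemma (in vectorspace) minimal_submodule_exists:
  assumes fd: "fin_dim" and W0: "submodule K W0 V" "P W0"
  obtains W where "submodule K W V" "P W"
    "\<And>U. submodule K U V \<Longrightarrow> P U \<Longrightarrow> U \<subseteq> W \<Longrightarrow> U = W"
proof -
  define Q where "Q = (\<lambda>n. \<exists>W. submodule K W V \<and> P W \<and>
    (\<forall>S. S \<subseteq> W \<longrightarrow> lin_indpt S \<longrightarrow> card S \<le> n))"
  have "Q dim"
    unfolding Q_def using W0 li_le_dim(2)[OF fd] by (meson order_trans submodule.subset)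
  moreover define N where "N = (LEAST n. Q n)"
  ultimately have "Q N"
    by (metis LeastI)
  then obtain W where W: "submodule K W V" "P W"
    and card: "\<And>S. S \<subseteq> W \<Longrightarrow> lin_indpt S \<Longrightarrow> card S \<le> N"
    unfolding Q_def by blast
  have "U = W" if U: "submodule K U V" "P U" "U \<subseteq> W" for U
  proof (rule ccontr)
    assume "U \<noteq> W"
    then obtain v where v: "v \<in> W" "v \<notin> U" using U(3) by blast
    have WV: "W \<subseteq> carrier V"
      using W(1) by (rule submodule.subset)
    have less: "card S < N" if S: "S \<subseteq> U" "lin_indpt S" for S
    proof -
      have "finite S"
        using li_le_dim(1)[OF fd _ S(2)] S(1) U(3) WV by blast
      moreover have "lin_indpt (insert v S)"
        using lin_indpt_insert[OF U(1) S] v WV by blast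
      ultimately show ?thesis
        using card[of "insert v S"] v S(1) U(3) by (auto simp: subset_iff card_insert_if split: if_splits)
    qed
    \<comment> \<open>The empty set shows that \<open>N\<close> is positive, so that
      \<open>N - 1\<close> on the naturals really is smaller than \<open>N\<close>.\<close>
    have "lin_indpt {}"
      by (auto simp: lin_dep_def)
    from less[OF _ this] have pos: "0 < N" by simp
    have "card S \<le> N - 1" if "S \<subseteq> U" "lin_indpt S" for S
      using less[OF that] by simp
    then have "Q (N - 1)"
      unfolding Q_def using U(1,2) by blast
    then have "N \<le> N - 1"
      unfolding N_def by (rule Least_le)
    then show False using pos by simp
  qed
  then show thesis using W that by blast
qed

section \<open>Minimal left ideals, idempotents and families of matrix units in a ring\<close>

context ring
begin

definition left_ideal :: "'a set \<Rightarrow> bool" where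
  "left_ideal L \<longleftrightarrow> L \<subseteq> carrier R \<and> \<zero> \<in> L \<and> (\<forall>x\<in>L. \<forall>y\<in>L. x \<oplus> y \<in> L) \<and>
    (\<forall>a\<in>carrier R. \<forall>x\<in>L. a \<otimes> x \<in> L)"

text \<open>For an idempotent \<open>e\<close> this is \<open>e R e\<close>. In terms of fixed
  points, \<open>e \<in> corner e\<close> says precisely that \<open>e\<close> is an idempotent of
  the ring.\<close>

definition corner :: "'a \<Rightarrow> 'a set" where
  "corner e = {x \<in> carrier R. e \<otimes> x = x \<and> x \<otimes> e = x}"

lemma left_ideal_minus:
  assumes "left_ideal L" "x \<in> L" "y \<in> L"
  shows "x \<ominus> y \<in> L"
proof -
  have c: "x \<in> carrier R" "y \<in> carrier R"
    using assms by (auto simp: left_ideal_def)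
  have "(\<ominus> \<one>) \<otimes> y \<in> L" using assms by (auto simp: left_ideal_def)
  moreover have "(\<ominus> \<one>) \<otimes> y = \<ominus> y" using c by (simp add: l_minus)
  ultimately show ?thesis
    using assms unfolding a_minus_def left_ideal_def by auto
qed

text \<open>This image of right multiplication by \<open>y\<close>, and its kernel in the next
  lemma, are the left ideals to which minimality will be applied.\<close>

lemma left_ideal_image_mult:
  assumes L: "left_ideal L" and y: "y \<in> carrier R"
  shows "left_ideal ((\<lambda>x. x \<otimes> y) ` L)"
proof -
  have LR: "L \<subseteq> carrier R" using L by (simp add: left_ideal_def)
  show ?thesis
    unfolding left_ideal_def
  proof (intro conjI ballI)
    show "(\<lambda>x. x \<otimes> y) ` L \<subseteq> carrier R" using LR y by auto
    show "\<zero> \<in> (\<lambda>x. x \<otimes> y) ` L"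
      using L y by (intro image_eqI[of _ _ \<zero>]) (auto simp: left_ideal_def)
  next
    fix p q assume "p \<in> (\<lambda>x. x \<otimes> y) ` L" "q \<in> (\<lambda>x. x \<otimes> y) ` L"
    then obtain s t where "s \<in> L" "t \<in> L" "p = s \<otimes> y" "q = t \<otimes> y" by blast
    then show "p \<oplus> q \<in> (\<lambda>x. x \<otimes> y) ` L"
      using L LR y by (intro image_eqI[of _ _ "s \<oplus> t"]) (auto simp: left_ideal_def l_distr subset_iff)
  next
    fix a p assume a: "a \<in> carrier R" and "p \<in> (\<lambda>x. x \<otimes> y) ` L"
    then obtain s where "s \<in> L" "p = s \<otimes> y" by blast
    then show "a \<otimes> p \<in> (\<lambda>x. x \<otimes> y) ` L"
      using L LR y a by (intro image_eqI[of _ _ "a \<otimes> s"]) (auto simp: left_ideal_def m_assoc subset_iff)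
  qed
qed

lemma left_ideal_annihilator:
  assumes L: "left_ideal L" and y: "y \<in> carrier R"
  shows "left_ideal {x \<in> L. x \<otimes> y = \<zero>}"
  using assms unfolding left_ideal_def
  by (auto simp: l_distr m_assoc subset_iff)

text \<open>Brauer's lemma. For a suitable \<open>y\<close> in \<open>L\<close>, right
  multiplication by \<open>y\<close> maps \<open>L\<close> onto \<open>L\<close> and is injective
  there. A preimage \<open>e\<close> of \<open>y\<close> is idempotent because
  \<open>e e - e\<close> is sent to zero. Minimality also makes right multiplication by a nonzero
  corner element \<open>x\<close> map \<open>L\<close> onto \<open>L\<close>, which yields a left
  inverse of \<open>x\<close>.\<close>

lemma minimal_left_ideal_division_idempotent:
  assumes prime: "\<And>a b. a \<in> carrier R \<Longrightarrow> b \<in> carrier R \<Longrightarrow>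
      (\<And>x. x \<in> carrier R \<Longrightarrow> a \<otimes> x \<otimes> b = \<zero>) \<Longrightarrow> a = \<zero> \<or> b = \<zero>"
    and L: "left_ideal L" "L \<noteq> {\<zero>}"
    and minimal: "\<And>M. left_ideal M \<Longrightarrow> M \<noteq> {\<zero>} \<Longrightarrow> M \<subseteq> L \<Longrightarrow> M = L"
  obtains e where "e \<in> corner e" "e \<noteq> \<zero>"
    "\<And>x. x \<in> corner e \<Longrightarrow> x \<noteq> \<zero> \<Longrightarrow> \<exists>y\<in>corner e. y \<otimes> x = e"
proof -
  have LR: "\<And>x. x \<in> L \<Longrightarrow> x \<in> carrier R" and L0: "\<zero> \<in> L"
    and Lm: "\<And>a x. a \<in> carrier R \<Longrightarrow> x \<in> L \<Longrightarrow> a \<otimes> x \<in> L"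
    using L(1) by (auto simp: left_ideal_def)
  obtain a where a: "a \<in> L" "a \<noteq> \<zero>" using L(2) L0 by blast
  obtain x where x: "x \<in> carrier R" "a \<otimes> x \<otimes> a \<noteq> \<zero>"
    using prime[of a a] a LR by blast
  \<comment> \<open>As \<open>a y\<close> is nonzero with \<open>a\<close> in \<open>L\<close>, the
    image \<open>L y\<close> is nonzero and the annihilator of \<open>y\<close> in \<open>L\<close>
    is not all of \<open>L\<close>.\<close>
  define y where "y = x \<otimes> a"
  have y: "y \<in> L" "y \<in> carrier R" "a \<otimes> y \<noteq> \<zero>"
    using x a LR Lm by (auto simp: y_def m_assoc)
  have "(\<lambda>x. x \<otimes> y) ` L = L"
  proof (rule minimal)
    show "left_ideal ((\<lambda>x. x \<otimes> y) ` L)" using left_ideal_image_mult L(1) y(2) .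
    show "(\<lambda>x. x \<otimes> y) ` L \<noteq> {\<zero>}" using a(1) y(3) by blast
    show "(\<lambda>x. x \<otimes> y) ` L \<subseteq> L" using Lm LR y by auto
  qed
  then obtain e where e: "e \<in> L" "e \<otimes> y = y" using y(1) by (metis (no_types, lifting) imageE)
  have eR: "e \<in> carrier R" using e LR by blast
  have y0: "y \<noteq> \<zero>" using y a LR by auto
  have e0: "e \<noteq> \<zero>" using e y0 y(2) by auto
  have ann: "{x \<in> L. x \<otimes> y = \<zero>} = {\<zero>}"
  proof (rule ccontr)
    assume "{x \<in> L. x \<otimes> y = \<zero>} \<noteq> {\<zero>}"
    from minimal[OF left_ideal_annihilator[OF L(1) y(2)] this]
    have "{x \<in> L. x \<otimes> y = \<zero>} = L" by blast
    then show False using a(1) y(3) by blast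
  qed
  have "(e \<otimes> e \<ominus> e) \<otimes> y = \<zero>"
    using e eR y(2) by (simp add: a_minus_def l_distr l_minus m_assoc r_neg)
  moreover have "e \<otimes> e \<ominus> e \<in> L"
    using left_ideal_minus[OF L(1)] Lm e eR by blast
  ultimately have "e \<otimes> e \<ominus> e = \<zero>" using ann by blast
  then have idem: "e \<otimes> e = e"
    using eR by simp
  have div: "\<exists>z\<in>corner e. z \<otimes> x = e" if x: "x \<in> corner e" "x \<noteq> \<zero>" for x
  proof -
    have xR: "x \<in> carrier R" "e \<otimes> x = x" "x \<otimes> e = x" using x(1) by (auto simp: corner_def)
    have xL: "x \<in> L" using Lm[OF xR(1) e(1)] xR(3) by simp
    \<comment> \<open>The image is nonzero because it contains \<open>e x = x\<close>.\<close>
    have "(\<lambda>z. z \<otimes> x) ` L = L"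
    proof (rule minimal)
      show "left_ideal ((\<lambda>z. z \<otimes> x) ` L)" using left_ideal_image_mult L(1) xR(1) .
      show "(\<lambda>z. z \<otimes> x) ` L \<noteq> {\<zero>}" using e(1) xR(2) x(2) by force
      show "(\<lambda>z. z \<otimes> x) ` L \<subseteq> L" using Lm LR xL by auto
    qed
    then obtain z where z: "z \<in> L" "z \<otimes> x = e" using e(1) by (metis imageE)
    have zR: "z \<in> carrier R" using z LR by blast
    \<comment> \<open>So far \<open>z\<close> is only known to lie in \<open>L\<close>. Multiplying
      by \<open>e\<close> on both sides moves it into the corner and keeps the product with
      \<open>x\<close> equal to \<open>e\<close>.\<close>
    have "e \<otimes> z \<otimes> e \<in> corner e"
      using zR eR idem by (simp add: corner_def m_assoc) (simp add: m_assoc[symmetric])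
    moreover have "(e \<otimes> z \<otimes> e) \<otimes> x = e"
      using zR eR xR z idem by (simp add: m_assoc)
    ultimately show ?thesis by blast
  qed
  show thesis
    using that[of e] idem eR e0 div by (auto simp: corner_def)
qed

text \<open>The products \<open>u i \<otimes> v j\<close> then multiply like matrix units. The value
  \<open>k = 0\<close> is allowed, so that the search for a longest family can start from the empty
  one.\<close>

definition matrix_unit_family :: "'a \<Rightarrow> nat \<Rightarrow> (nat \<Rightarrow> 'a) \<Rightarrow> (nat \<Rightarrow> 'a) \<Rightarrow> bool" where
  "matrix_unit_family e k u v \<longleftrightarrow>
    (\<forall>i<k. u i \<in> carrier R \<and> u i \<otimes> e = u i \<and> v i \<in> carrier R \<and> e \<otimes> v i = v i) \<and>
    (\<forall>i<k. \<forall>j<k. v i \<otimes> u j = (if i = j then e else \<zero>))"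

lemma matrix_unit_familyD:
  assumes "matrix_unit_family e k u v" "i < k"
  shows "u i \<in> carrier R" "u i \<otimes> e = u i" "v i \<in> carrier R" "e \<otimes> v i = v i"
    "j < k \<Longrightarrow> v i \<otimes> u j = (if i = j then e else \<zero>)"
  using assms by (auto simp: matrix_unit_family_def)

text \<open>Only the term with index \<open>i\<close> survives in either product. Hence
  \<open>\<one> \<ominus> f\<close> is orthogonal to the family on the sides where a new pair has to
  be.\<close>

lemma matrix_unit_family_sum:
  assumes "matrix_unit_family e k u v" and e: "e \<in> carrier R"
  defines "f \<equiv> \<Oplus>i\<in>{..<k}. u i \<otimes> v i"
  shows "f \<in> carrier R" "i < k \<Longrightarrow> v i \<otimes> f = v i" "i < k \<Longrightarrow> f \<otimes> u i = u i"
proof -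
  note D = matrix_unit_familyD[OF assms(1)]
  show "f \<in> carrier R"
    unfolding f_def using D by (intro finsum_closed) auto
  show "v i \<otimes> f = v i" if i: "i < k"
  proof -
    have "v i \<otimes> f = (\<Oplus>j\<in>{..<k}. v i \<otimes> (u j \<otimes> v j))"
      unfolding f_def using D i by (intro finsum_rdistr) auto
    also have "\<dots> = (\<Oplus>j\<in>{..<k}. if i = j then v j else \<zero>)"
      using D i by (intro finsum_cong') (auto simp: m_assoc[symmetric])
    also have "\<dots> = v i"
      using D i by (intro finsum_singleton) auto
    finally show ?thesis .
  qed
  show "f \<otimes> u i = u i" if i: "i < k"
  proof -
    have "f \<otimes> u i = (\<Oplus>j\<in>{..<k}. u j \<otimes> v j \<otimes> u i)"
      unfolding f_def using D i by (intro finsum_ldistr) auto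
    also have "\<dots> = (\<Oplus>j\<in>{..<k}. if i = j then u j else \<zero>)"
      using D i by (intro finsum_cong') (auto simp: m_assoc)
    also have "\<dots> = u i"
      using D i by (intro finsum_singleton) auto
    finally show ?thesis .
  qed
qed

lemma matrix_unit_family_extend:
  assumes prime: "\<And>a b. a \<in> carrier R \<Longrightarrow> b \<in> carrier R \<Longrightarrow>
      (\<And>x. x \<in> carrier R \<Longrightarrow> a \<otimes> x \<otimes> b = \<zero>) \<Longrightarrow> a = \<zero> \<or> b = \<zero>"
    and e: "e \<in> corner e" "e \<noteq> \<zero>"
    and div: "\<And>x. x \<in> corner e \<Longrightarrow> x \<noteq> \<zero> \<Longrightarrow> \<exists>y\<in>corner e. y \<otimes> x = e"
    and fam: "matrix_unit_family e k u v"
    and ne: "(\<Oplus>i\<in>{..<k}. u i \<otimes> v i) \<noteq> \<one>"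
  obtains u' v' where "matrix_unit_family e (Suc k) u' v'"
proof -
  define f where "f = (\<Oplus>i\<in>{..<k}. u i \<otimes> v i)"
  note D = matrix_unit_familyD[OF fam]
  have eR: "e \<in> carrier R" "e \<otimes> e = e" using e by (auto simp: corner_def)
  note F = matrix_unit_family_sum[OF fam eR(1), folded f_def]
  define g where "g = \<one> \<ominus> f"
  have gR: "g \<in> carrier R" using F by (simp add: g_def)
  have vg: "v i \<otimes> g = \<zero>" and gu: "g \<otimes> u i = \<zero>" if "i < k" for i
    using F that D[OF that] by (simp_all add: g_def a_minus_def r_distr l_distr r_minus l_minus r_neg)
  have "g \<noteq> \<zero>" using ne F by (auto simp: g_def f_def)
  \<comment> \<open>Primeness is used twice: for \<open>g\<close> and \<open>e\<close> it gives
    \<open>x\<close>, then for \<open>e\<close> and \<open>g x e\<close> it gives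
    \<open>y\<close>.\<close>
  then obtain x where x: "x \<in> carrier R" "g \<otimes> x \<otimes> e \<noteq> \<zero>"
    using prime[of g e] gR eR e by blast
  then obtain y where y: "y \<in> carrier R" "e \<otimes> y \<otimes> (g \<otimes> x \<otimes> e) \<noteq> \<zero>"
    using prime[of e "g \<otimes> x \<otimes> e"] gR eR e by blast
  have "e \<otimes> y \<otimes> (g \<otimes> x \<otimes> e) \<in> corner e"
    using y x gR eR by (simp add: corner_def m_assoc) (simp add: m_assoc[symmetric])
  from div[OF this y(2)] obtain w where w: "w \<in> corner e" "w \<otimes> (e \<otimes> y \<otimes> (g \<otimes> x \<otimes> e)) = e"
    by blast
  have wR: "w \<in> carrier R" "e \<otimes> w = w" "w \<otimes> e = w" using w by (auto simp: corner_def)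
  \<comment> \<open>The new pair. The factor \<open>g\<close> makes the mixed products with the old
    family vanish, and \<open>w\<close> normalizes \<open>q p\<close> to \<open>e\<close>.\<close>
  define p where "p = g \<otimes> x \<otimes> e"
  define q where "q = w \<otimes> y \<otimes> g"
  \<comment> \<open>The product \<open>q p\<close> contains \<open>g\<close> twice, whereas the
    element inverted by \<open>w\<close> contains it once. Idempotence follows from
    \<open>g f = 0\<close>.\<close>
  have gg: "g \<otimes> g = g"
  proof -
    have "g \<otimes> f = (\<Oplus>i\<in>{..<k}. g \<otimes> (u i \<otimes> v i))"
      unfolding f_def using gR D by (intro finsum_rdistr) auto
    also have "\<dots> = (\<Oplus>i\<in>{..<k}. \<zero>)"
      using gR D gu by (intro finsum_cong') (auto simp: m_assoc[symmetric])
    finally have gf: "g \<otimes> f = \<zero>" by simp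
    have "g \<otimes> g = g \<otimes> \<one> \<ominus> g \<otimes> f"
      using gR F(1) by (subst (2) g_def) (simp add: a_minus_def r_distr r_minus)
    then show ?thesis using gf gR by (simp add: a_minus_def)
  qed
  have qp: "q \<otimes> p = e"
  proof -
    have "q \<otimes> p = w \<otimes> (y \<otimes> (g \<otimes> g \<otimes> (x \<otimes> e)))"
      using wR y x gR eR by (simp add: p_def q_def m_assoc)
    also have "\<dots> = w \<otimes> e \<otimes> (y \<otimes> (g \<otimes> (x \<otimes> e)))"
      using wR(3) by (simp add: gg)
    also have "\<dots> = e"
      using w(2) wR(1) y x gR eR by (simp add: m_assoc)
    finally show ?thesis .
  qed
  have pq: "p \<in> carrier R" "q \<in> carrier R" "p \<otimes> e = p" "e \<otimes> q = q"
    using wR y x gR eR by (simp_all add: p_def q_def m_assoc) (simp add: m_assoc[symmetric])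
  have vp: "v i \<otimes> p = \<zero>" and qu: "q \<otimes> u i = \<zero>" if "i < k" for i
  proof -
    show "v i \<otimes> p = \<zero>"
      using vg[OF that] D[OF that] x gR eR by (simp add: p_def m_assoc[symmetric])
    show "q \<otimes> u i = \<zero>"
      using gu[OF that] D[OF that] wR y gR eR by (simp add: q_def m_assoc)
  qed
  have "matrix_unit_family e (Suc k) (u(k := p)) (v(k := q))"
    using D pq qp vp qu unfolding matrix_unit_family_def by (auto simp: less_Suc_eq)
  then show thesis by (rule that)
qed

end

section \<open>Records for corners, and entrywise rules for matrix algebras\<close>

definition corner_algebra :: "('f, 'a, 'h) module_scheme \<Rightarrow> 'a \<Rightarrow> ('f, 'a) module" where
  "corner_algebra A e = \<lparr>carrier = ring.corner A e, monoid.mult = (\<otimes>\<^bsub>A\<^esub>), one = e,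
    zero = \<zero>\<^bsub>A\<^esub>, add = (\<oplus>\<^bsub>A\<^esub>), smult = (\<odot>\<^bsub>A\<^esub>)\<rparr>"

lemma corner_algebra_simps [simp]:
  "carrier (corner_algebra A e) = ring.corner A e"
  "x \<otimes>\<^bsub>corner_algebra A e\<^esub> y = x \<otimes>\<^bsub>A\<^esub> y"
  "\<one>\<^bsub>corner_algebra A e\<^esub> = e"
  "\<zero>\<^bsub>corner_algebra A e\<^esub> = \<zero>\<^bsub>A\<^esub>"
  "x \<oplus>\<^bsub>corner_algebra A e\<^esub> y = x \<oplus>\<^bsub>A\<^esub> y"
  "c \<odot>\<^bsub>corner_algebra A e\<^esub> x = c \<odot>\<^bsub>A\<^esub> x"
  by (simp_all add: corner_algebra_def)

lemma matrix_algebra_carrier_iff: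
  "X \<in> carrier (matrix_algebra n D) \<longleftrightarrow>
    X \<in> carrier_mat n n \<and> (\<forall>i<n. \<forall>j<n. X $$ (i, j) \<in> carrier D)"
  by (auto simp: matrix_algebra_def dest!: elements_matD)

lemma matrix_algebra_simps [simp]:
  "X \<otimes>\<^bsub>matrix_algebra n D\<^esub> Y =
    mat n n (\<lambda>(i, j). \<Oplus>\<^bsub>D\<^esub>k\<in>{..<n}. X $$ (i, k) \<otimes>\<^bsub>D\<^esub> Y $$ (k, j))"
  "X \<oplus>\<^bsub>matrix_algebra n D\<^esub> Y = mat n n (\<lambda>(i, j). X $$ (i, j) \<oplus>\<^bsub>D\<^esub> Y $$ (i, j))"
  "c \<odot>\<^bsub>matrix_algebra n D\<^esub> X = mat n n (\<lambda>(i, j). c \<odot>\<^bsub>D\<^esub> X $$ (i, j))"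
  by (simp_all add: matrix_algebra_def)

section \<open>Left ideals and the dimension bound in a unital algebra\<close>

context unital_algebra
begin

sublocale A: ring A
  by (intro ringI monoidI M.abelian_group_axioms)
    (auto simp: mult_closed mult_assoc unity_closed unity_left unity_right mult_add_left mult_add_right)

text \<open>With a unity, scalars act through multiplication by elements of the algebra; this is why
  left ideals are subspaces.\<close>

lemma smult_as_mult:
  assumes "c \<in> carrier F" "x \<in> carrier A"
  shows "c \<odot>\<^bsub>A\<^esub> x = (c \<odot>\<^bsub>A\<^esub> \<one>\<^bsub>A\<^esub>) \<otimes>\<^bsub>A\<^esub> x"
  using assms by (simp add: mult_smult_left)

lemma left_ideal_submodule:
  assumes "A.left_ideal L"
  shows "submodule F L A"
proof (intro submodule.intro module_axioms)
  show "c \<odot>\<^bsub>A\<^esub> x \<in> L" if "c \<in> carrier F" "x \<in> L" for c x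
  proof -
    have "x \<in> carrier A" using that assms by (auto simp: A.left_ideal_def)
    with that assms show ?thesis
      by (subst smult_as_mult) (auto simp: A.left_ideal_def)
  qed
qed (use assms in \<open>auto simp: A.left_ideal_def\<close>)

text \<open>Left ideals are subspaces, so the descent on dimension applies to the property of being
  a nonzero left ideal. It starts from the whole algebra, which is nonzero because its unity
  is.\<close>

lemma minimal_left_ideal_exists:
  assumes fd: "fin_dim"
  obtains L where "A.left_ideal L" "L \<noteq> {\<zero>\<^bsub>A\<^esub>}"
    "\<And>M. A.left_ideal M \<Longrightarrow> M \<noteq> {\<zero>\<^bsub>A\<^esub>} \<Longrightarrow> M \<subseteq> L \<Longrightarrow> M = L"
proof -
  let ?P = "\<lambda>W. A.left_ideal W \<and> W \<noteq> {\<zero>\<^bsub>A\<^esub>}"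
  have P: "?P (carrier A)"
    using unity_nonzero unity_closed by (auto simp: A.left_ideal_def)
  then have "submodule F (carrier A) A" by (intro left_ideal_submodule) simp
  from minimal_submodule_exists[of _ ?P, OF fd this P] obtain L where
    "?P L" "\<And>U. submodule F U A \<Longrightarrow> ?P U \<Longrightarrow> U \<subseteq> L \<Longrightarrow> U = L"
    by metis
  then show thesis
    using that left_ideal_submodule by blast
qed

text \<open>The \<open>u i\<close> are linearly independent: \<open>v k\<close> annihilates \<open>u i\<close> for \<open>i < k\<close> but not \<open>u k\<close>.\<close>

lemma matrix_unit_family_le_dim:
  assumes fd: "fin_dim" and e: "e \<noteq> \<zero>\<^bsub>A\<^esub>" and fam: "A.matrix_unit_family e n u v"
  shows "n \<le> dim"
proof -
  note D = A.matrix_unit_familyD[OF fam]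
  \<comment> \<open>The cardinality is carried along because independence of the image set alone
    does not exclude repetitions among the \<open>u i\<close>.\<close>
  have "lin_indpt (u ` {..<k}) \<and> card (u ` {..<k}) = k" if "k \<le> n" for k
    using that
  proof (induction k)
    case 0
    then show ?case by (simp add: lin_dep_def)
  next
    case (Suc k)
    then have IH: "lin_indpt (u ` {..<k})" "card (u ` {..<k}) = k" and k: "k < n" by auto
    define W where "W = {x \<in> carrier A. v k \<otimes>\<^bsub>A\<^esub> x = \<zero>\<^bsub>A\<^esub>}"
    have vk: "v k \<in> carrier A" using D k by blast
    have W: "submodule F W A"
      by (intro submodule.intro module_axioms)
        (use vk in \<open>auto simp: W_def A.r_distr mult_smult_right\<close>)
    have sub: "u ` {..<k} \<subseteq> W" using D k by (auto simp: W_def)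
    have notin: "u k \<notin> W" using D(5)[OF k k] e by (auto simp: W_def)
    have "lin_indpt (insert (u k) (u ` {..<k}))"
      using lin_indpt_insert[OF W sub IH(1) _ notin] D k by blast
    moreover have "u k \<notin> u ` {..<k}" using sub notin by blast
    ultimately show ?case
      using IH(2) by (simp add: lessThan_Suc)
  qed
  from this[of n] have "lin_indpt (u ` {..<n})" "card (u ` {..<n}) = n" by auto
  then show ?thesis
    using li_le_dim(2)[OF fd, of "u ` {..<n}"] D by auto
qed

section \<open>The corner as a division algebra, and the isomorphism onto matrices over it\<close>

lemma corner_submodule:
  assumes "e \<in> carrier A"
  shows "submodule F (A.corner e) A"
  by (intro submodule.intro module_axioms)
    (use assms in \<open>auto simp: A.corner_def A.r_distr A.l_distr mult_smult_left mult_smult_right\<close>)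

lemma corner_algebra_unital:
  assumes e: "e \<in> A.corner e" "e \<noteq> \<zero>\<^bsub>A\<^esub>"
  shows "unital_algebra F (corner_algebra A e)"
proof -
  have eA: "e \<in> carrier A" and sub: "\<And>x. x \<in> A.corner e \<Longrightarrow> x \<in> carrier A"
    using e by (auto simp: A.corner_def)
  \<comment> \<open>This record differs from \<open>corner_algebra A e\<close>. It supplies the
    closure properties, and the laws themselves are inherited from \<open>A\<close>.\<close>
  interpret S: Module.module F "md (A.corner e)"
    by (rule submodule_is_module[OF corner_submodule[OF eA]])
  have "abelian_group (corner_algebra A e)"
  proof (rule abelian_groupI)
    fix x assume "x \<in> carrier (corner_algebra A e)"
    then show "\<exists>y\<in>carrier (corner_algebra A e).
        y \<oplus>\<^bsub>corner_algebra A e\<^esub> x = \<zero>\<^bsub>corner_algebra A e\<^esub>"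
      using eA by (intro bexI[of _ "\<ominus>\<^bsub>A\<^esub> x"]) (auto simp: A.corner_def M.l_neg A.l_minus A.r_minus)
  qed (use S.M.a_closed S.M.zero_closed sub in \<open>auto simp: M.a_ac\<close>)
  then have "Module.module F (corner_algebra A e)"
    by (intro moduleI R.is_cring)
      (use S.smult_closed sub in \<open>auto simp: smult_l_distr smult_r_distr smult_assoc1\<close>)
  then have "vectorspace F (corner_algebra A e)"
    by (intro vectorspace.intro field_axioms)
  then show ?thesis
    by (intro unital_algebra.intro assoc_algebra.intro
        assoc_algebra_axioms.intro unital_algebra_axioms.intro)
      (use e eA in \<open>auto simp: A.corner_def A.l_distr A.r_distr A.m_assoc mult_smult_left
        mult_smult_right simp flip: A.m_assoc[of e]\<close>)
qed

text \<open>Left inverses of all nonzero elements suffice: a left inverse \<open>y\<close> of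
  \<open>x\<close> is nonzero and has a left inverse \<open>z\<close> itself, and
  \<open>z = z (y x) = (z y) x = x\<close>.\<close>

lemma corner_algebra_division:
  assumes e: "e \<in> A.corner e" "e \<noteq> \<zero>\<^bsub>A\<^esub>"
    and div: "\<And>x. x \<in> A.corner e \<Longrightarrow> x \<noteq> \<zero>\<^bsub>A\<^esub> \<Longrightarrow> \<exists>y\<in>A.corner e. y \<otimes>\<^bsub>A\<^esub> x = e"
  shows "division_algebra F (corner_algebra A e)"
proof (intro division_algebra.intro division_algebra_axioms.intro corner_algebra_unital[OF e])
  fix x assume x: "x \<in> carrier (corner_algebra A e)" "x \<noteq> \<zero>\<^bsub>corner_algebra A e\<^esub>"
  then obtain y where y: "y \<in> A.corner e" "y \<otimes>\<^bsub>A\<^esub> x = e" using div by auto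
  have "y \<noteq> \<zero>\<^bsub>A\<^esub>" using y(2) x e(2) by (auto simp: A.corner_def)
  then obtain z where z: "z \<in> A.corner e" "z \<otimes>\<^bsub>A\<^esub> y = e" using div y by blast
  have "z = z \<otimes>\<^bsub>A\<^esub> (y \<otimes>\<^bsub>A\<^esub> x)" using y(2) z(1) by (simp add: A.corner_def)
  also have "\<dots> = x" using x y(1) z by (simp add: A.corner_def flip: A.m_assoc)
  finally show "x \<in> Units (corner_algebra A e)"
    using x y z by (auto simp: Units_def)
qed

text \<open>A matrix product over the corner sums in the corner record, while the distributive
  computations take place in \<open>A\<close>; this is the passage between them.\<close>

lemma finsum_corner_algebra:
  assumes e: "e \<in> A.corner e" "e \<noteq> \<zero>\<^bsub>A\<^esub>" and "finite S" "f \<in> S \<rightarrow> A.corner e"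
  shows "finsum (corner_algebra A e) f S = finsum A f S"
proof -
  interpret D: unital_algebra F "corner_algebra A e" by (rule corner_algebra_unital[OF e])
  have sub: "A.corner e \<subseteq> carrier A" by (auto simp: A.corner_def)
  show ?thesis
    using assms(3,4)
  proof (induction S)
    case (insert x S)
    then have "f \<in> S \<rightarrow> carrier A" "f x \<in> carrier A" using sub by auto
    with insert show ?case by simp
  qed simp
qed

text \<open>The decomposition \<open>one\<close> of the unity makes \<open>\<phi>\<close>
  multiplicative and \<open>\<psi>\<close> a left inverse of it. The relations between the
  \<open>v i\<close> and the \<open>u j\<close> make \<open>\<psi>\<close> a right inverse.\<close>

lemma matrix_algebra_corner_iso:
  assumes e: "e \<in> A.corner e" "e \<noteq> \<zero>\<^bsub>A\<^esub>"
    and fam: "A.matrix_unit_family e n u v"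
    and one: "(\<Oplus>\<^bsub>A\<^esub>i\<in>{..<n}. u i \<otimes>\<^bsub>A\<^esub> v i) = \<one>\<^bsub>A\<^esub>"
  shows "algebra_isomorphic F A (matrix_algebra n (corner_algebra A e))"
proof -
  note D = A.matrix_unit_familyD[OF fam]
  interpret Q: unital_algebra F "corner_algebra A e" by (rule corner_algebra_unital[OF e])
  have eA: "e \<in> carrier A" using e by (simp add: A.corner_def)
  define \<phi> where "\<phi> = (\<lambda>a. mat n n (\<lambda>(i, j). v i \<otimes>\<^bsub>A\<^esub> a \<otimes>\<^bsub>A\<^esub> u j))"
  define \<psi> where "\<psi> = (\<lambda>X. \<Oplus>\<^bsub>A\<^esub>i\<in>{..<n}. \<Oplus>\<^bsub>A\<^esub>j\<in>{..<n}. u i \<otimes>\<^bsub>A\<^esub> X $$ (i, j) \<otimes>\<^bsub>A\<^esub> v j)"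
  let ?M = "matrix_algebra n (corner_algebra A e)"
  have corner: "v i \<otimes>\<^bsub>A\<^esub> a \<otimes>\<^bsub>A\<^esub> u j \<in> A.corner e" if "a \<in> carrier A" "i < n" "j < n" for a i j
    using D[OF that(2)] D[OF that(3)] that(1) eA
    by (simp add: A.corner_def A.m_assoc) (simp flip: A.m_assoc)
  have closed: "\<phi> a \<in> carrier ?M" if "a \<in> carrier A" for a
    using corner that by (simp add: matrix_algebra_carrier_iff \<phi>_def)
  have hom: "\<phi> (a \<otimes>\<^bsub>A\<^esub> b) = \<phi> a \<otimes>\<^bsub>?M\<^esub> \<phi> b" if ab: "a \<in> carrier A" "b \<in> carrier A" for a b
  proof (rule eq_matI)
    fix i j assume "i < dim_row (\<phi> a \<otimes>\<^bsub>?M\<^esub> \<phi> b)" "j < dim_col (\<phi> a \<otimes>\<^bsub>?M\<^esub> \<phi> b)"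
    then have ij: "i < n" "j < n" by auto
    note Di = D(1-4)[OF ij(1)] and Dj = D(1-4)[OF ij(2)]
    \<comment> \<open>The unity inserted between \<open>a\<close> and \<open>b\<close> is expanded
      into the sum of the \<open>u k v k\<close>, whose index becomes the summation index of the
      matrix product.\<close>
    have "\<phi> (a \<otimes>\<^bsub>A\<^esub> b) $$ (i, j) = (v i \<otimes>\<^bsub>A\<^esub> a) \<otimes>\<^bsub>A\<^esub> (\<one>\<^bsub>A\<^esub> \<otimes>\<^bsub>A\<^esub> (b \<otimes>\<^bsub>A\<^esub> u j))"
      using ij ab Di Dj by (simp add: \<phi>_def A.m_assoc)
    also have "\<one>\<^bsub>A\<^esub> \<otimes>\<^bsub>A\<^esub> (b \<otimes>\<^bsub>A\<^esub> u j) = (\<Oplus>\<^bsub>A\<^esub>k\<in>{..<n}. u k \<otimes>\<^bsub>A\<^esub> v k \<otimes>\<^bsub>A\<^esub> (b \<otimes>\<^bsub>A\<^esub> u j))"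
      unfolding one[symmetric] using D ab Dj by (intro A.finsum_ldistr) auto
    also have "(v i \<otimes>\<^bsub>A\<^esub> a) \<otimes>\<^bsub>A\<^esub> \<dots> =
        (\<Oplus>\<^bsub>A\<^esub>k\<in>{..<n}. (v i \<otimes>\<^bsub>A\<^esub> a) \<otimes>\<^bsub>A\<^esub> (u k \<otimes>\<^bsub>A\<^esub> v k \<otimes>\<^bsub>A\<^esub> (b \<otimes>\<^bsub>A\<^esub> u j)))"
      using D ab Di Dj by (intro A.finsum_rdistr) auto
    also have "\<dots> = (\<Oplus>\<^bsub>A\<^esub>k\<in>{..<n}. (v i \<otimes>\<^bsub>A\<^esub> a \<otimes>\<^bsub>A\<^esub> u k) \<otimes>\<^bsub>A\<^esub> (v k \<otimes>\<^bsub>A\<^esub> b \<otimes>\<^bsub>A\<^esub> u j))"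
      using D ab Di Dj by (intro M.finsum_cong') (auto simp: A.m_assoc)
    also have "\<dots> = (\<Oplus>\<^bsub>corner_algebra A e\<^esub>k\<in>{..<n}.
        (v i \<otimes>\<^bsub>A\<^esub> a \<otimes>\<^bsub>A\<^esub> u k) \<otimes>\<^bsub>A\<^esub> (v k \<otimes>\<^bsub>A\<^esub> b \<otimes>\<^bsub>A\<^esub> u j))"
      using corner ij ab Q.mult_closed by (intro finsum_corner_algebra[OF e, symmetric]) auto
    also have "\<dots> = (\<phi> a \<otimes>\<^bsub>?M\<^esub> \<phi> b) $$ (i, j)"
      using corner ij ab Q.mult_closed by (simp add: \<phi>_def cong: Q.M.finsum_cong)
    finally show "\<phi> (a \<otimes>\<^bsub>A\<^esub> b) $$ (i, j) = (\<phi> a \<otimes>\<^bsub>?M\<^esub> \<phi> b) $$ (i, j)" .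
  qed (auto simp: \<phi>_def)
  have module_hom: "\<phi> \<in> LinearCombinations.module_hom F A ?M"
    using closed D
    by (auto simp: LinearCombinations.module_hom_def \<phi>_def A.l_distr A.r_distr
        mult_smult_left mult_smult_right intro!: eq_matI)
  have \<psi>\<phi>: "\<psi> (\<phi> a) = a" if a: "a \<in> carrier A" for a
  proof -
    have row: "(\<Oplus>\<^bsub>A\<^esub>j\<in>{..<n}. u i \<otimes>\<^bsub>A\<^esub> \<phi> a $$ (i, j) \<otimes>\<^bsub>A\<^esub> v j) = u i \<otimes>\<^bsub>A\<^esub> v i \<otimes>\<^bsub>A\<^esub> a"
      if i: "i < n" for i
    proof -
      have "(\<Oplus>\<^bsub>A\<^esub>j\<in>{..<n}. u i \<otimes>\<^bsub>A\<^esub> \<phi> a $$ (i, j) \<otimes>\<^bsub>A\<^esub> v j) =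
          (\<Oplus>\<^bsub>A\<^esub>j\<in>{..<n}. (u i \<otimes>\<^bsub>A\<^esub> v i \<otimes>\<^bsub>A\<^esub> a) \<otimes>\<^bsub>A\<^esub> (u j \<otimes>\<^bsub>A\<^esub> v j))"
        using D i a by (intro M.finsum_cong') (auto simp: \<phi>_def A.m_assoc)
      also have "\<dots> = (u i \<otimes>\<^bsub>A\<^esub> v i \<otimes>\<^bsub>A\<^esub> a) \<otimes>\<^bsub>A\<^esub> \<one>\<^bsub>A\<^esub>"
        unfolding one[symmetric] using D i a by (intro A.finsum_rdistr[symmetric]) auto
      finally show ?thesis using D i a by simp
    qed
    have "\<psi> (\<phi> a) = (\<Oplus>\<^bsub>A\<^esub>i\<in>{..<n}. u i \<otimes>\<^bsub>A\<^esub> v i \<otimes>\<^bsub>A\<^esub> a)"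
      unfolding \<psi>_def using D a row by (intro M.finsum_cong') auto
    also have "\<dots> = \<one>\<^bsub>A\<^esub> \<otimes>\<^bsub>A\<^esub> a"
      unfolding one[symmetric] using D a by (intro A.finsum_ldistr[symmetric]) auto
    finally show ?thesis using a by simp
  qed
  have \<phi>\<psi>: "\<psi> X \<in> carrier A" "\<phi> (\<psi> X) = X" if X: "X \<in> carrier ?M" for X
  proof -
    have X': "X \<in> carrier_mat n n"
      and Xc: "\<And>i j. i < n \<Longrightarrow> j < n \<Longrightarrow> X $$ (i, j) \<in> carrier A"
        "\<And>i j. i < n \<Longrightarrow> j < n \<Longrightarrow> e \<otimes>\<^bsub>A\<^esub> X $$ (i, j) = X $$ (i, j)"
        "\<And>i j. i < n \<Longrightarrow> j < n \<Longrightarrow> X $$ (i, j) \<otimes>\<^bsub>A\<^esub> e = X $$ (i, j)"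
      using X by (auto simp: matrix_algebra_carrier_iff A.corner_def)
    \<comment> \<open>The contribution of row \<open>i\<close> to \<open>\<psi> X\<close>.
      Multiplication by \<open>u l\<close> on the right selects column \<open>l\<close>; afterwards
      \<open>v k\<close> on the left selects row \<open>k\<close>.\<close>
    define T where "T = (\<lambda>i. \<Oplus>\<^bsub>A\<^esub>j\<in>{..<n}. u i \<otimes>\<^bsub>A\<^esub> X $$ (i, j) \<otimes>\<^bsub>A\<^esub> v j)"
    have T: "T i \<in> carrier A" if "i < n" for i
      unfolding T_def using D Xc that by (intro M.finsum_closed) auto
    have \<psi>: "\<psi> X = (\<Oplus>\<^bsub>A\<^esub>i\<in>{..<n}. T i)" by (simp add: \<psi>_def T_def)
    show closed: "\<psi> X \<in> carrier A"
      unfolding \<psi> using T by (intro M.finsum_closed) auto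
    have Tu: "T i \<otimes>\<^bsub>A\<^esub> u l = u i \<otimes>\<^bsub>A\<^esub> X $$ (i, l)" if il: "i < n" "l < n" for i l
    proof -
      have "T i \<otimes>\<^bsub>A\<^esub> u l = (\<Oplus>\<^bsub>A\<^esub>j\<in>{..<n}. u i \<otimes>\<^bsub>A\<^esub> X $$ (i, j) \<otimes>\<^bsub>A\<^esub> v j \<otimes>\<^bsub>A\<^esub> u l)"
        unfolding T_def using D Xc il by (intro A.finsum_ldistr) auto
      also have "\<dots> = (\<Oplus>\<^bsub>A\<^esub>j\<in>{..<n}. if l = j then u i \<otimes>\<^bsub>A\<^esub> X $$ (i, j) else \<zero>\<^bsub>A\<^esub>)"
        using D Xc il by (intro M.finsum_cong') (auto simp: A.m_assoc)
      also have "\<dots> = u i \<otimes>\<^bsub>A\<^esub> X $$ (i, l)"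
        using D Xc il by (intro M.finsum_singleton) auto
      finally show ?thesis .
    qed
    have "v k \<otimes>\<^bsub>A\<^esub> \<psi> X \<otimes>\<^bsub>A\<^esub> u l = X $$ (k, l)" if kl: "k < n" "l < n" for k l
    proof -
      have "v k \<otimes>\<^bsub>A\<^esub> \<psi> X \<otimes>\<^bsub>A\<^esub> u l = v k \<otimes>\<^bsub>A\<^esub> (\<psi> X \<otimes>\<^bsub>A\<^esub> u l)"
        using D kl closed by (simp add: A.m_assoc)
      also have "\<psi> X \<otimes>\<^bsub>A\<^esub> u l = (\<Oplus>\<^bsub>A\<^esub>i\<in>{..<n}. T i \<otimes>\<^bsub>A\<^esub> u l)"
        unfolding \<psi> using T D kl by (intro A.finsum_ldistr) auto
      also have "\<dots> = (\<Oplus>\<^bsub>A\<^esub>i\<in>{..<n}. u i \<otimes>\<^bsub>A\<^esub> X $$ (i, l))"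
        using Tu D Xc kl by (intro M.finsum_cong') auto
      also have "v k \<otimes>\<^bsub>A\<^esub> \<dots> = (\<Oplus>\<^bsub>A\<^esub>i\<in>{..<n}. v k \<otimes>\<^bsub>A\<^esub> (u i \<otimes>\<^bsub>A\<^esub> X $$ (i, l)))"
        using D Xc kl by (intro A.finsum_rdistr) auto
      also have "\<dots> = (\<Oplus>\<^bsub>A\<^esub>i\<in>{..<n}. if k = i then X $$ (i, l) else \<zero>\<^bsub>A\<^esub>)"
        using D Xc kl by (intro M.finsum_cong') (auto simp flip: A.m_assoc)
      also have "\<dots> = X $$ (k, l)"
        using Xc kl by (intro M.finsum_singleton) auto
      finally show ?thesis .
    qed
    then show "\<phi> (\<psi> X) = X"
      using X' by (intro eq_matI) (auto simp: \<phi>_def)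
  qed
  have "bij_betw \<phi> (carrier A) (carrier ?M)"
    by (rule bij_betw_byWitness[where f' = \<psi>]) (use closed \<psi>\<phi> \<phi>\<psi> in auto)
  then show ?thesis
    unfolding algebra_isomorphic_def using module_hom hom closed by (auto simp: hom_def)
qed

end

section \<open>Primeness of matrix algebras over division algebras\<close>

lemma (in division_algebra) matrix_algebra_mult_nonzero:
  assumes X: "X \<in> carrier (matrix_algebra n D)" "i < n" "j < n" "X $$ (i, j) \<noteq> \<zero>\<^bsub>D\<^esub>"
    and Y: "Y \<in> carrier (matrix_algebra n D)" "k < n" "l < n" "Y $$ (k, l) \<noteq> \<zero>\<^bsub>D\<^esub>"
  obtains Z where "Z \<in> carrier (matrix_algebra n D)"
    "(X \<otimes>\<^bsub>matrix_algebra n D\<^esub> Z \<otimes>\<^bsub>matrix_algebra n D\<^esub> Y) $$ (i, l) \<noteq> \<zero>\<^bsub>D\<^esub>"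
proof -
  have Xc: "X $$ (p, q) \<in> carrier D" and Yc: "Y $$ (p, q) \<in> carrier D" if "p < n" "q < n" for p q
    using X(1) Y(1) that by (auto simp: matrix_algebra_carrier_iff)
  define E where "E = mat n n (\<lambda>(p, q). if p = j \<and> q = k then \<one>\<^bsub>D\<^esub> else \<zero>\<^bsub>D\<^esub>)"
  have E: "E \<in> carrier (matrix_algebra n D)"
    by (auto simp: matrix_algebra_carrier_iff E_def)
  \<comment> \<open>Multiplication by the matrix unit moves column \<open>j\<close> of
    \<open>X\<close> to column \<open>k\<close>.\<close>
  have XE: "(X \<otimes>\<^bsub>matrix_algebra n D\<^esub> E) $$ (i, q) = (if q = k then X $$ (i, j) else \<zero>\<^bsub>D\<^esub>)"
    if q: "q < n" for q
  proof -
    have "(X \<otimes>\<^bsub>matrix_algebra n D\<^esub> E) $$ (i, q) =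
        (\<Oplus>\<^bsub>D\<^esub>p\<in>{..<n}. X $$ (i, p) \<otimes>\<^bsub>D\<^esub> E $$ (p, q))"
      using X(2) q by simp
    also have "\<dots> =
        (\<Oplus>\<^bsub>D\<^esub>p\<in>{..<n}. if j = p then (if q = k then X $$ (i, p) else \<zero>\<^bsub>D\<^esub>) else \<zero>\<^bsub>D\<^esub>)"
      using Xc X(2) q by (intro M.finsum_cong') (auto simp: E_def)
    also have "\<dots> = (if q = k then X $$ (i, j) else \<zero>\<^bsub>D\<^esub>)"
      using Xc X(2,3) by (subst M.finsum_singleton) auto
    finally show ?thesis .
  qed
  have "(X \<otimes>\<^bsub>matrix_algebra n D\<^esub> E \<otimes>\<^bsub>matrix_algebra n D\<^esub> Y) $$ (i, l) =
      (\<Oplus>\<^bsub>D\<^esub>q\<in>{..<n}. (X \<otimes>\<^bsub>matrix_algebra n D\<^esub> E) $$ (i, q) \<otimes>\<^bsub>D\<^esub> Y $$ (q, l))"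
    using X(2) Y(3) by (subst matrix_algebra_simps(1)) simp
  also have "\<dots> = (\<Oplus>\<^bsub>D\<^esub>q\<in>{..<n}. if k = q then X $$ (i, j) \<otimes>\<^bsub>D\<^esub> Y $$ (q, l) else \<zero>\<^bsub>D\<^esub>)"
    using Xc Yc X Y by (intro M.finsum_cong') (auto simp: XE simp del: matrix_algebra_simps)
  also have "\<dots> = X $$ (i, j) \<otimes>\<^bsub>D\<^esub> Y $$ (k, l)"
    using Xc Yc X Y by (intro M.finsum_singleton) auto
  finally have eq: "(X \<otimes>\<^bsub>matrix_algebra n D\<^esub> E \<otimes>\<^bsub>matrix_algebra n D\<^esub> Y) $$ (i, l) =
      X $$ (i, j) \<otimes>\<^bsub>D\<^esub> Y $$ (k, l)" .
  have "X $$ (i, j) \<in> Units D"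
    using nonzero_invertible Xc X by blast
  then obtain x where x: "x \<in> carrier D" "x \<otimes>\<^bsub>D\<^esub> X $$ (i, j) = \<one>\<^bsub>D\<^esub>"
    by (auto simp: Units_def)
  have "X $$ (i, j) \<otimes>\<^bsub>D\<^esub> Y $$ (k, l) \<noteq> \<zero>\<^bsub>D\<^esub>"
  proof
    assume "X $$ (i, j) \<otimes>\<^bsub>D\<^esub> Y $$ (k, l) = \<zero>\<^bsub>D\<^esub>"
    then have "x \<otimes>\<^bsub>D\<^esub> X $$ (i, j) \<otimes>\<^bsub>D\<^esub> Y $$ (k, l) = \<zero>\<^bsub>D\<^esub>"
      using x(1) Xc X(2,3) Yc Y(2,3) by (simp add: A.m_assoc)
    then show False using x Yc Y(2-4) by simp
  qed
  then show thesis by (intro that[OF E]) (simp only: eq not_False_eq_True)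
qed

text \<open>By injectivity, nonzero elements have images with a nonzero entry. By surjectivity, the
  matrix separating two such images comes from an element of \<open>A\<close>.\<close>

lemma prime_if_isomorphic_matrix_algebra:
  assumes "unital_algebra F A" "division_algebra F D" "algebra_isomorphic F A (matrix_algebra n D)"
  shows "prime_algebra A"
proof -
  interpret A: unital_algebra F A by fact
  interpret D: division_algebra F D by fact
  let ?M = "matrix_algebra n D"
  obtain \<phi> where mh: "\<phi> \<in> LinearCombinations.module_hom F A ?M" and hom: "\<phi> \<in> hom A ?M"
    and bij: "bij_betw \<phi> (carrier A) (carrier ?M)"
    using assms(3) by (auto simp: algebra_isomorphic_def)
  have \<phi>: "\<phi> a \<in> carrier ?M" if "a \<in> carrier A" for a
    using hom that by (auto simp: hom_def)
  \<comment> \<open>No module structure on the matrices has been established, so additivity of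
    \<open>\<phi>\<close> is combined with cancellation in \<open>D\<close>, entry by entry.\<close>
  have \<phi>0: "\<phi> \<zero>\<^bsub>A\<^esub> $$ (i, j) = \<zero>\<^bsub>D\<^esub>" if "i < n" "j < n" for i j
  proof -
    have "\<phi> \<zero>\<^bsub>A\<^esub> = \<phi> \<zero>\<^bsub>A\<^esub> \<oplus>\<^bsub>?M\<^esub> \<phi> \<zero>\<^bsub>A\<^esub>"
      using LinearCombinations.module_hom_add[OF mh, of "\<zero>\<^bsub>A\<^esub>" "\<zero>\<^bsub>A\<^esub>"] by simp
    then have "\<phi> \<zero>\<^bsub>A\<^esub> $$ (i, j) = (\<phi> \<zero>\<^bsub>A\<^esub> \<oplus>\<^bsub>?M\<^esub> \<phi> \<zero>\<^bsub>A\<^esub>) $$ (i, j)"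
      by (rule arg_cong)
    then have "\<phi> \<zero>\<^bsub>A\<^esub> $$ (i, j) = \<phi> \<zero>\<^bsub>A\<^esub> $$ (i, j) \<oplus>\<^bsub>D\<^esub> \<phi> \<zero>\<^bsub>A\<^esub> $$ (i, j)"
      using that by simp
    moreover have "\<phi> \<zero>\<^bsub>A\<^esub> $$ (i, j) \<in> carrier D"
      using \<phi>[of "\<zero>\<^bsub>A\<^esub>"] that by (simp add: matrix_algebra_carrier_iff)
    ultimately show ?thesis by (metis D.M.add.l_cancel_one')
  qed
  have entry: "\<exists>i<n. \<exists>j<n. \<phi> a $$ (i, j) \<noteq> \<zero>\<^bsub>D\<^esub>" if a: "a \<in> carrier A" "a \<noteq> \<zero>\<^bsub>A\<^esub>" for a
  proof (rule ccontr)
    assume "\<not> ?thesis"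
    then have "\<phi> a = \<phi> \<zero>\<^bsub>A\<^esub>"
      using \<phi>[OF a(1)] \<phi>[of "\<zero>\<^bsub>A\<^esub>"] \<phi>0 by (intro eq_matI) (auto simp: matrix_algebra_carrier_iff)
    then show False
      using bij a by (metis A.M.zero_closed bij_betw_imp_inj_on inj_on_eq_iff)
  qed
  have nonzero: "\<exists>x\<in>carrier A. a \<otimes>\<^bsub>A\<^esub> x \<otimes>\<^bsub>A\<^esub> b \<noteq> \<zero>\<^bsub>A\<^esub>"
    if a: "a \<in> carrier A" "a \<noteq> \<zero>\<^bsub>A\<^esub>" and b: "b \<in> carrier A" "b \<noteq> \<zero>\<^bsub>A\<^esub>" for a b
  proof -
    obtain i j where ij: "i < n" "j < n" "\<phi> a $$ (i, j) \<noteq> \<zero>\<^bsub>D\<^esub>" using entry[OF a] by blast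
    obtain k l where kl: "k < n" "l < n" "\<phi> b $$ (k, l) \<noteq> \<zero>\<^bsub>D\<^esub>" using entry[OF b] by blast
    obtain Z where Z: "Z \<in> carrier ?M" "(\<phi> a \<otimes>\<^bsub>?M\<^esub> Z \<otimes>\<^bsub>?M\<^esub> \<phi> b) $$ (i, l) \<noteq> \<zero>\<^bsub>D\<^esub>"
      using D.matrix_algebra_mult_nonzero[OF \<phi>[OF a(1)] ij \<phi>[OF b(1)] kl] by blast
    obtain x where x: "x \<in> carrier A" "Z = \<phi> x"
      using Z(1) bij by (metis bij_betw_imp_surj_on imageE)
    have "\<phi> (a \<otimes>\<^bsub>A\<^esub> x \<otimes>\<^bsub>A\<^esub> b) = \<phi> a \<otimes>\<^bsub>?M\<^esub> Z \<otimes>\<^bsub>?M\<^esub> \<phi> b"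
      using hom_mult[OF hom] a b x by (simp del: matrix_algebra_simps)
    then have "a \<otimes>\<^bsub>A\<^esub> x \<otimes>\<^bsub>A\<^esub> b \<noteq> \<zero>\<^bsub>A\<^esub>"
      using Z(2) \<phi>0[OF ij(1) kl(2)] by metis
    then show ?thesis using x by blast
  qed
  show ?thesis
    unfolding prime_algebra_def
  proof (intro ballI impI)
    fix a b
    assume ab: "a \<in> carrier A" "b \<in> carrier A"
      and zero: "(\<lambda>x. a \<otimes>\<^bsub>A\<^esub> x \<otimes>\<^bsub>A\<^esub> b) ` carrier A = {\<zero>\<^bsub>A\<^esub>}"
    have "a \<otimes>\<^bsub>A\<^esub> x \<otimes>\<^bsub>A\<^esub> b = \<zero>\<^bsub>A\<^esub>" if "x \<in> carrier A" for x
      using imageI[OF that, of "\<lambda>x. a \<otimes>\<^bsub>A\<^esub> x \<otimes>\<^bsub>A\<^esub> b"] unfolding zero by (rule singletonD)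
    then show "a = \<zero>\<^bsub>A\<^esub> \<or> b = \<zero>\<^bsub>A\<^esub>"
      using nonzero[OF ab(1) _ ab(2)] by metis
  qed
qed

section \<open>From prime algebras to matrix algebras, and the equivalence\<close>

lemma (in unital_algebra) prime_algebra_imp_isomorphic_matrix_algebra:
  assumes fd: "fin_dim" and "prime_algebra A"
  obtains n and D :: "('f, 'a) module" where
    "n > 0" "division_algebra F D" "algebra_isomorphic F A (matrix_algebra n D)"
proof -
  have prime: "a = \<zero>\<^bsub>A\<^esub> \<or> b = \<zero>\<^bsub>A\<^esub>"
    if "a \<in> carrier A" "b \<in> carrier A" "\<And>x. x \<in> carrier A \<Longrightarrow> a \<otimes>\<^bsub>A\<^esub> x \<otimes>\<^bsub>A\<^esub> b = \<zero>\<^bsub>A\<^esub>" for a b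
  proof -
    \<comment> \<open>Equality, and not only inclusion, because the carrier is nonempty.\<close>
    have "(\<lambda>x. a \<otimes>\<^bsub>A\<^esub> x \<otimes>\<^bsub>A\<^esub> b) ` carrier A = {\<zero>\<^bsub>A\<^esub>}"
      using that(3) M.zero_closed by auto
    then show ?thesis using assms(2) that(1,2) unfolding prime_algebra_def by blast
  qed
  obtain L where L: "A.left_ideal L" "L \<noteq> {\<zero>\<^bsub>A\<^esub>}"
    "\<And>M. A.left_ideal M \<Longrightarrow> M \<noteq> {\<zero>\<^bsub>A\<^esub>} \<Longrightarrow> M \<subseteq> L \<Longrightarrow> M = L"
    using minimal_left_ideal_exists[OF fd] by blast
  obtain e where e: "e \<in> A.corner e" "e \<noteq> \<zero>\<^bsub>A\<^esub>"
    and div: "\<And>x. x \<in> A.corner e \<Longrightarrow> x \<noteq> \<zero>\<^bsub>A\<^esub> \<Longrightarrow> \<exists>y\<in>A.corner e. y \<otimes>\<^bsub>A\<^esub> x = e"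
    using A.minimal_left_ideal_division_idempotent[OF prime L] by blast
  define P where "P = (\<lambda>n. \<exists>u v. A.matrix_unit_family e n u v)"
  have "P 0" by (simp add: P_def A.matrix_unit_family_def)
  moreover have bound: "\<forall>n. P n \<longrightarrow> n \<le> dim"
    using matrix_unit_family_le_dim[OF fd e(2)] by (auto simp: P_def)
  ultimately obtain n where n: "P n" "\<And>m. P m \<Longrightarrow> m \<le> n"
    using Nat.ex_has_greatest_nat[of P 0 dim] by blast
  obtain u v where fam: "A.matrix_unit_family e n u v" using n(1) by (auto simp: P_def)
  have one: "(\<Oplus>\<^bsub>A\<^esub>i\<in>{..<n}. u i \<otimes>\<^bsub>A\<^esub> v i) = \<one>\<^bsub>A\<^esub>"
  proof (rule ccontr)
    assume "\<not> ?thesis"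
    then obtain u' v' where "A.matrix_unit_family e (Suc n) u' v'"
      using A.matrix_unit_family_extend[OF prime e div fam] by blast
    then show False using n(2)[of "Suc n"] by (auto simp: P_def)
  qed
  \<comment> \<open>For \<open>n = 0\<close> the sum is empty, and the unity would be zero.\<close>
  then have "n > 0" using unity_nonzero by (cases n) auto
  with that show thesis
    using corner_algebra_division[OF e div] matrix_algebra_corner_iso[OF e fam one] by blast
qed

text \<open>An existential quantifier cannot range over types, so \<open>D\<close> is sought over
  the element type of \<open>A\<close>; this suffices because the division algebra found is a corner
  of \<open>A\<close>. The second conjunct gives the converse for division algebras over an
  arbitrary type \<open>'d\<close>.\<close>

theorem theorem3p1:
  fixes F :: "('f, 'g) ring_scheme" and A :: "('f, 'a, 'h) module_scheme"
  assumes "unital_algebra F A" and "vectorspace.fin_dim F A"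
  shows "(prime_algebra A \<longleftrightarrow>
      (\<exists>n::nat. n > 0 \<and> (\<exists>D :: ('f, 'a) module.
        division_algebra F D \<and> algebra_isomorphic F A (matrix_algebra n D))))
    \<and> (\<forall>(n::nat) (D :: ('f, 'd) module).
        n > 0 \<and> division_algebra F D \<and> algebra_isomorphic F A (matrix_algebra n D)
          \<longrightarrow> prime_algebra A)"
proof -
  interpret unital_algebra F A by fact
  have "\<exists>n>0. \<exists>D :: ('f, 'a) module.
      division_algebra F D \<and> algebra_isomorphic F A (matrix_algebra n D)" if "prime_algebra A"
    by (rule prime_algebra_imp_isomorphic_matrix_algebra[OF assms(2) that]) blast
  then show ?thesis
    by (auto intro: prime_if_isomorphic_matrix_algebra[OF assms(1)])
qed

end
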